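(* Let $n \ge 1$ and let $K \subset \mathbb{C}^n$ be a closed set which is Reinhardt complete, i.e. whenever $(z_1,\dots,z_n) \in K$ and $(w_1,\dots,w_n) \in \mathbb{C}^n$ satisfies $|w_k| \le |z_k|$ for $k=1,\dots,n$, then $(w_1,\dots,w_n) \in K$. Then $K$ supports the complex $S$-inequality: for every cylinder $C = \{z \in \mathbb{C}^n : |z_1| \le R\}$ (with $R \ge 0$), $$\nu_n(K) = \nu_n(C) \quad \Longrightarrow \quad \nu_n(tK) \ge \nu_n(tC) \ \text{ for all } t \ge 1.$$
   Context: $\nu_n$ denotes the standard Gaussian measure on $\mathbb{C}^n$, i.e. $\nu_n(A) = \gamma_{2n}(\tau(A))$ for Borel $A \subset \mathbb{C}^n$, where $\tau(z_1,\dots,z_n) = (\mathrm{Re}\, z_1, \mathrm{Im}\, z_1, \dots, \mathrm{Re}\, z_n, \mathrm{Im}\, z_n) \in \mathbb{R}^{2n}$ and $\gamma_{2n}$ is the standard Gaussian measure on $\mathbb{R}^{2n}$, with density $(2\pi)^{-n} e^{-|x|^2/2}$, $|x|$ being the Euclidean norm. For $t>0$ and a set $A$, $tA = \{ta : a \in A\}$. *)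

theory Defs
  imports "HOL-Analysis.Analysis"
begin

text \<open>
  \<^item> \<open>\<complex>\<^sup>n\<close> is \<^typ>\<open>complex ^ 'n\<close> with \<open>n = CARD('n)\<close>; as types are inhabited, \<open>n \<ge> 1\<close>.
  \<^item> \<open>\<real>\<^sup>2\<^sup>n\<close> is \<^typ>\<open>real ^ ('n \<times> 2)\<close>; index \<open>(k, 1)\<close> holds the real part and
    index \<open>(k, 2)\<close> the imaginary part of the \<open>k\<close>-th complex coordinate. (In the
    two-element type \<^typ>\<open>2\<close> the numeral \<open>2\<close> equals \<open>0\<close>, which differs from \<open>1\<close>.)
\<close>

definition real_coords :: "complex ^ 'n \<Rightarrow> real ^ ('n::finite \<times> 2)" where
  "real_coords z = (\<chi> p. if snd p = 1 then Re (z $ fst p) else Im (z $ fst p))"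

definition real_gaussian :: "(real ^ ('n::finite \<times> 2)) measure" where
  "real_gaussian =
    density lborel (\<lambda>x. ennreal (exp (- (norm x)\<^sup>2 / 2) / (2 * pi) ^ CARD('n)))"

text \<open>
  The pushforward under the inverse of \<^const>\<open>real_coords\<close>;
  the lemma \<open>emeasure_complex_gaussian\<close> below gives its values on Borel sets.
\<close>

definition complex_gaussian :: "(complex ^ 'n::finite) measure" where
  "complex_gaussian = distr real_gaussian borel (inv real_coords)"

lemma real_coords_inverse:
  "real_coords (\<chi> k. Complex (x $ (k, 1)) (x $ (k, 2))) = x"
proof -
  have "real_coords (\<chi> k. Complex (x $ (k, 1)) (x $ (k, 2))) $ (k, q) = x $ (k, q)" for k q
    using exhaust_2[of q] by (auto simp: real_coords_def)
  then show ?thesis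
    by (simp add: vec_eq_iff split_paired_all)
qed

lemma inj_real_coords: "inj real_coords"
proof (rule injI)
  fix z w :: "complex ^ 'n"
  assume eq: "real_coords z = real_coords w"
  have "Re (z $ k) = Re (w $ k)" "Im (z $ k) = Im (w $ k)" for k
    using arg_cong[OF eq, of "\<lambda>x. x $ (k, 1)"] arg_cong[OF eq, of "\<lambda>x. x $ (k, 2)"]
    by (simp_all add: real_coords_def)
  then show "z = w" by (simp add: vec_eq_iff complex_eq_iff)
qed

lemma inv_real_coords:
  "inv real_coords = (\<lambda>x. \<chi> k. Complex (x $ (k, 1)) (x $ (k, 2)))"
proof (rule ext)
  fix x :: "real ^ ('n::finite \<times> 2)"
  show "inv real_coords x = (\<chi> k. Complex (x $ (k, 1)) (x $ (k, 2)))"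
    by (rule inv_f_eq[OF inj_real_coords real_coords_inverse])
qed

lemma bij_real_coords: "bij real_coords"
  by (intro bijI inj_real_coords surjI[of _ "\<lambda>x. \<chi> k. Complex (x $ (k, 1)) (x $ (k, 2))"]
      real_coords_inverse)

lemma borel_measurable_inv_real_coords:
  "inv (real_coords :: complex ^ 'n::finite \<Rightarrow> _) \<in> borel_measurable borel"
  unfolding inv_real_coords
  by (intro borel_measurable_continuous_onI continuous_intros continuous_on_vec_lambda)

lemma emeasure_complex_gaussian:
  fixes A :: "(complex ^ 'n::finite) set"
  assumes "A \<in> sets borel"
  shows "emeasure complex_gaussian A = emeasure real_gaussian (real_coords ` A)"
proof -
  have "inv real_coords -` A = real_coords ` A"
    using bij_vimage_eq_inv_image[OF bij_imp_bij_inv[OF bij_real_coords]]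
    by (simp add: inv_inv_eq[OF bij_real_coords])
  moreover have "space (real_gaussian :: (real ^ ('n \<times> 2)) measure) = UNIV"
    by (simp add: real_gaussian_def)
  moreover have "inv (real_coords :: complex ^ 'n \<Rightarrow> _) \<in> measurable real_gaussian borel"
    using borel_measurable_inv_real_coords by (simp add: real_gaussian_def)
  ultimately show ?thesis
    using assms by (simp add: complex_gaussian_def emeasure_distr)
qed

definition Reinhardt_complete :: "(complex ^ 'n) set \<Rightarrow> bool" where
  "Reinhardt_complete K \<longleftrightarrow>
    (\<forall>z\<in>K. \<forall>w. (\<forall>k. cmod (w $ k) \<le> cmod (z $ k)) \<longrightarrow> w \<in> K)"

definition dilate :: "real \<Rightarrow> (complex ^ 'n) set \<Rightarrow> (complex ^ 'n) set" where
  "dilate t A = (\<lambda>z. t *\<^sub>R z) ` A"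

definition cylinder :: "'n \<Rightarrow> real \<Rightarrow> (complex ^ 'n) set" where
  "cylinder j R = {z. cmod (z $ j) \<le> R}"

text \<open>
  An abstract finite index type has no distinguished first coordinate, so the base
  coordinate \<open>j\<close> of the cylinder ranges over all indices; \<^const>\<open>complex_gaussian\<close>
  is invariant under permutations of the coordinates.
\<close>

definition supports_complex_S_inequality :: "(complex ^ 'n::finite) set \<Rightarrow> bool" where
  "supports_complex_S_inequality K \<longleftrightarrow>
    (\<forall>(j::'n) R. 0 \<le> R \<longrightarrow>
      emeasure complex_gaussian K = emeasure complex_gaussian (cylinder j R) \<longrightarrow>
      (\<forall>t\<ge>1. emeasure complex_gaussian (dilate t K)
              \<ge> emeasure complex_gaussian (dilate t (cylinder j R))))"

end

theory Submission
  imports Defs "HOL-Probability.Probability"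
begin

text \<open>
  Under \<open>\<nu>\<^sub>n\<close> the variables \<open>x\<^sub>k = |z\<^sub>k|\<^sup>2 / 2\<close> are independent standard exponentials, the complement
  of \<open>K\<close> becomes an upper set \<open>U\<close> in these coordinates, and dilation of \<open>K\<close> by \<open>t\<close> becomes dilation of
  \<open>U\<close> by \<open>s = t\<^sup>2\<close>. For cylinders \<open>\<mu>(sU) = \<mu>(U)\<^sup>s\<close>, so it suffices that \<open>\<mu>(sU) \<le> \<mu>(U)\<^sup>s\<close> for every
  upper set \<open>U\<close>. More generally, \<open>\<integral> F(x/s)\<^sup>s d\<mu> \<le> (\<integral> F d\<mu>)\<^sup>s\<close> for every coordinatewise increasing
  \<open>F\<close> with values in \<open>[0,1]\<close>. This functional form tensorises by Fubini. On the line it is Minkowski's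
  inequality in \<open>L\<^sup>s\<close> applied to the layers \<open>1{F > l}\<close>, each of which is a half-line and gives equality.
\<close>

section \<open>Dilations and the exponential distribution\<close>

abbreviation std_exponential :: "real measure" where
  "std_exponential \<equiv> density lborel (\<lambda>x. ennreal (exponential_density 1 x))"

lemma prob_space_std_exponential: "prob_space std_exponential"
  by (rule prob_space_exponential_density) simp

text \<open>The cutoff \<open>max a 0\<close> appears because the law lives on the positive
  half-line. Open and closed tails agree since points are null; having both lets an upper set be
  squeezed between them.\<close>

lemma measure_std_exponential_tail:
  "measure std_exponential {a<..} = exp (- max a 0)"
  "measure std_exponential {a..} = exp (- max a 0)"
proof -
  have "(\<integral>\<^sup>+x. ennreal (exponential_density 1 x) * indicator {a..} x \<partial>lborel)
      = (\<integral>\<^sup>+x. ennreal (exp (-x)) * indicator {max a 0..} x \<partial>lborel)"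
    by (intro nn_integral_cong) (auto simp: exponential_density_def indicator_def)
  also have "\<dots> = ennreal (0 - (- exp (- max a 0)))"
  proof (rule nn_integral_FTC_atLeast)
    show "((\<lambda>x::real. - exp (-x)) \<longlongrightarrow> 0) at_top"
      by real_asymp
  qed (auto intro!: derivative_eq_intros)
  finally have 1: "emeasure std_exponential {a..} = ennreal (exp (- max a 0))"
    by (simp add: emeasure_density)
  then show "measure std_exponential {a..} = exp (- max a 0)"
    by (simp add: measure_def)
  have "emeasure std_exponential {a<..} = emeasure std_exponential {a..}"
  proof (rule emeasure_eq_AE)
    show "AE x in std_exponential. x \<in> {a<..} \<longleftrightarrow> x \<in> {a..}"
      using AE_lborel_singleton[of a] by (subst AE_density) (auto elim: eventually_mono)
  qed auto
  then show "measure std_exponential {a<..} = exp (- max a 0)"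
    using 1 by (simp add: measure_def)
qed

text \<open>A nonempty upper set with infimum \<open>a\<close> differs from a half-line in at most
  one point. Scaling moves \<open>a\<close> to \<open>a * s\<close>, which raises the tail
  \<open>exp (- max a 0)\<close> to the power \<open>s\<close>. These sets are the equality case of
  the dilation inequality.\<close>

lemma std_exponential_upper_set:
  fixes U :: "real set"
  assumes upper: "\<And>x y. x \<in> U \<Longrightarrow> x \<le> y \<Longrightarrow> y \<in> U"
    and meas: "U \<in> sets borel" and s: "0 < s"
  shows "measure std_exponential {x. x / s \<in> U} = measure std_exponential U powr s"
    and "U \<noteq> {} \<Longrightarrow> 0 < measure std_exponential U"
proof -
  interpret E: prob_space std_exponential by (rule prob_space_std_exponential)
  have [measurable]: "{x. x / s \<in> U} \<in> sets borel"
    using meas by measurable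
  have *: "measure std_exponential {x. x / s \<in> U} = measure std_exponential U powr s
     \<and> 0 < measure std_exponential U" if "U \<noteq> {}"
  proof (cases "bdd_below U")
    case True
    define a where "a = Inf U"
    have sub: "U \<subseteq> {a..}" using True by (auto simp: a_def cInf_lower)
    have sup: "{a<..} \<subseteq> U"
      using cInf_less_iff[OF that True] upper by (auto simp: a_def intro: less_imp_le)
    have U: "measure std_exponential U = exp (- max a 0)"
      using E.finite_measure_mono[OF sub] E.finite_measure_mono[OF sup] meas
      by (simp add: measure_std_exponential_tail)
    have sub': "{x. x / s \<in> U} \<subseteq> {a * s..}" using sub s by (auto simp: field_simps)
    have sup': "{a * s<..} \<subseteq> {x. x / s \<in> U}" using sup s by (auto simp: field_simps)
    have "measure std_exponential {x. x / s \<in> U} = exp (- max (a * s) 0)"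
      using E.finite_measure_mono[OF sub'] E.finite_measure_mono[OF sup']
      by (simp add: measure_std_exponential_tail)
    then show ?thesis
      using s by (cases "0 \<le> a") (auto simp: U powr_def max_def mult_le_0_iff mult.commute)
  next
    \<comment> \<open>Without a lower bound the upper set is the whole line, and both measures are
      1.\<close>
    case False
    have "U = UNIV"
    proof (intro set_eqI iffI UNIV_I)
      fix x
      from False obtain y where "y \<in> U" "y < x" by (auto simp: bdd_below_def not_le)
      then show "x \<in> U" using upper[of y x] by simp
    qed
    then show ?thesis using E.prob_space by simp
  qed
  then show "U \<noteq> {} \<Longrightarrow> 0 < measure std_exponential U" by blast
  show "measure std_exponential {x. x / s \<in> U} = measure std_exponential U powr s"
    using * by (cases "U = {}") auto
qed

section \<open>Minkowski's inequality for layers on the line\<close>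

text \<open>Bernoulli's inequality for nonpositive exponents: combine
  \<open>ln x \<le> x - 1\<close> with \<open>1 + u \<le> exp u\<close> at
  \<open>u = p * ln x\<close>.\<close>

lemma powr_tangent:
  fixes x p :: real
  assumes "0 < x" "p \<le> 0"
  shows "1 + p * (x - 1) \<le> x powr p"
proof -
  have "p * (x - 1) \<le> p * ln x"
    using assms ln_le_minus_one[of x] by (intro mult_left_mono_neg) auto
  then show ?thesis
    using assms exp_ge_add_one_self[of "p * ln x"] by (simp add: powr_def del: exp_ge_add_one_self)
qed

text \<open>For \<open>s > 1\<close> this is Hoelder's inequality for the factors
  \<open>w powr ((s - 1) / s)\<close> and \<open>w powr ((1 - s) / s)\<close>, whose product is 1 on
  \<open>{0..<r}\<close>, together with the total mass 1 of \<open>w\<close>. A suitable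
  \<open>w\<close> later turns it into Minkowski's inequality.\<close>

lemma powr_le_nn_integral_layers:
  fixes w :: "real \<Rightarrow> real"
  assumes [measurable]: "w \<in> borel_measurable borel"
    and w_mass: "(\<integral>\<^sup>+l. indicator {0..} l * ennreal (w l) \<partial>lborel) = 1"
    and w_pos: "\<And>l. 0 \<le> l \<Longrightarrow> l < r \<Longrightarrow> 0 < w l"
    and r: "0 \<le> r" and s: "1 \<le> s"
  shows "ennreal (r powr s)
    \<le> (\<integral>\<^sup>+l. indicator {0..} l * indicator {l. l < r} l * ennreal (w l powr (1 - s)) \<partial>lborel)"
proof (cases "r = 0")
  case False
  with r have r0: "0 < r" by simp
  \<comment> \<open>Integrate over \<open>{0..<r}\<close> the tangent bound
    \<open>w powr (1 - s) \<ge> s * r powr (s - 1) - (s - 1) * r powr s * w\<close> at \<open>w = 1 / r\<close>.\<close>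
  have "ennreal (s * r powr s) = (\<integral>\<^sup>+l. ennreal (s * r powr (s - 1)) * indicator {0..<r} l \<partial>lborel)"
    using r0 s by (subst nn_integral_cmult) (auto simp flip: ennreal_mult simp: powr_diff)
  also have "\<dots> \<le> (\<integral>\<^sup>+l. indicator {0..} l * indicator {l. l < r} l * ennreal (w l powr (1 - s))
        + ennreal ((s - 1) * r powr s) * (indicator {0..} l * ennreal (w l)) \<partial>lborel)"
  proof (intro nn_integral_mono)
    fix l
    show "ennreal (s * r powr (s - 1)) * indicator {0..<r} l
      \<le> indicator {0..} l * indicator {l. l < r} l * ennreal (w l powr (1 - s))
        + ennreal ((s - 1) * r powr s) * (indicator {0..} l * ennreal (w l))"
    proof (cases "l \<in> {0..<r}")
      case True
      then have wl: "0 < w l" by (simp add: w_pos)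
      have "1 + (1 - s) * (w l * r - 1) \<le> (w l * r) powr (1 - s)"
        by (rule powr_tangent) (use wl r0 s in auto)
      then have "r powr (s - 1) * (1 + (1 - s) * (w l * r - 1)) \<le> r powr (s - 1) * (w l * r) powr (1 - s)"
        by (intro mult_left_mono) auto
      also have "\<dots> = w l powr (1 - s)"
        using wl r0 by (simp add: powr_mult powr_diff)
      also have "r powr (s - 1) * (1 + (1 - s) * (w l * r - 1))
         = s * r powr (s - 1) - (s - 1) * (r powr (s - 1) * r) * w l"
        by (simp add: algebra_simps)
      also have "r powr (s - 1) * r = r powr s" using r0 by (simp add: powr_diff)
      finally have "s * r powr (s - 1) \<le> w l powr (1 - s) + (s - 1) * r powr s * w l" by simp
      then have "ennreal (s * r powr (s - 1)) \<le> ennreal (w l powr (1 - s)) + ennreal ((s - 1) * r powr s) * ennreal (w l)"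
        using s wl by (simp add: ennreal_leI flip: ennreal_plus ennreal_mult)
      then show ?thesis using True by simp
    qed simp
  qed
  \<comment> \<open>The correction term was kept at every level \<open>l \<ge> 0\<close>, not only
    below \<open>r\<close>, so that its integral is given exactly by the mass of
    \<open>w\<close>.\<close>
  also have "\<dots> = (\<integral>\<^sup>+l. indicator {0..} l * indicator {l. l < r} l * ennreal (w l powr (1 - s)) \<partial>lborel)
      + ennreal ((s - 1) * r powr s)"
    by (subst nn_integral_add) (auto simp: nn_integral_cmult w_mass)
  finally have le: "ennreal (s * r powr s) \<le>
      (\<integral>\<^sup>+l. indicator {0..} l * indicator {l. l < r} l * ennreal (w l powr (1 - s)) \<partial>lborel)
      + ennreal ((s - 1) * r powr s)" .
  \<comment> \<open>Subtraction in \<open>ennreal\<close> is avoided by splitting the left side and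
    cancelling a finite summand.\<close>
  have "ennreal (s * r powr s) = ennreal (r powr s) + ennreal ((s - 1) * r powr s)"
    using s ennreal_plus[of "r powr s" "(s - 1) * r powr s"] mult_right_mono[OF s, of "r powr s"]
    by (simp add: left_diff_distrib)
  with le have "ennreal ((s - 1) * r powr s) + ennreal (r powr s) \<le> ennreal ((s - 1) * r powr s) +
      (\<integral>\<^sup>+l. indicator {0..} l * indicator {l. l < r} l * ennreal (w l powr (1 - s)) \<partial>lborel)"
    by (simp only: add.commute)
  then show ?thesis
    unfolding ennreal_add_left_cancel_le infinity_ennreal_def
    using ennreal_neq_top by blast
qed simp

text \<open>The \<open>s\<close>-norm of \<open>g (x / s)\<close> is at most the integral over
  \<open>l\<close> of the \<open>s\<close>-norms of the layers. The layer at level \<open>l\<close>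
  has norm \<open>m l\<close>, because its measure is \<open>m l powr s\<close>, and these norms
  integrate to \<open>c\<close>.\<close>

lemma std_exponential_dilation:
  fixes g :: "real \<Rightarrow> real"
  assumes mono: "mono g" and g0: "\<And>x. 0 \<le> g x" and g1: "\<And>x. g x \<le> 1" and s: "1 \<le> s"
  shows "(\<integral>x. g (x / s) powr s \<partial>std_exponential) \<le> (\<integral>x. g x \<partial>std_exponential) powr s"
proof -
  let ?E = std_exponential
  interpret E: prob_space ?E by (rule prob_space_std_exponential)
  interpret P: pair_sigma_finite ?E "lborel :: real measure" ..
  have g[measurable]: "g \<in> borel_measurable borel" by (rule borel_measurable_mono[OF mono])
  define m where "m l = measure ?E {x. l < g x}" for l
  define c where "c = (\<integral>x. g x \<partial>?E)"
  have "mono (\<lambda>l. - m l)"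
    unfolding m_def by (auto intro!: monoI E.finite_measure_mono)
  then have "(\<lambda>l. - m l) \<in> borel_measurable borel" by (rule borel_measurable_mono)
  then have m[measurable]: "m \<in> borel_measurable borel"
    by (simp add: borel_measurable_uminus_eq)
  have upper: "y \<in> {x. l < g x}" if "x \<in> {x. l < g x}" "x \<le> y" for x y l
    using that monoD[OF mono, of x y] by auto
  have m_pos: "0 < m l" if "l < g y" for l y
    unfolding m_def using that upper
    by (intro std_exponential_upper_set(2)[where s=1]) (auto simp del: mem_Collect_eq)
  have m_s: "measure ?E {x. l < g (x / s)} = m l powr s" for l
    unfolding m_def using std_exponential_upper_set(1)[of "{x. l < g x}" s] upper s
    by auto
  have int: "integrable ?E g"
    using g0 g1 by (intro E.integrable_const_bound[of _ 1]) auto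
  show ?thesis
  \<comment> \<open>If \<open>g\<close> vanishes identically then \<open>c = 0\<close>, and
    \<open>m\<close> cannot be normalised to a probability density.\<close>
  proof (cases "\<exists>y. 0 < g y")
    case False
    then have "g x = 0" for x using g0[of x] by (auto simp: less_le)
    then show ?thesis by simp
  next
    case True
    then obtain y where y: "0 < g y" by blast
    \<comment> \<open>Layer-cake formula, by exchanging the integrals over \<open>x\<close> and
      \<open>l\<close>.\<close>
    have c_mass: "(\<integral>\<^sup>+l. indicator {0..} l * ennreal (m l) \<partial>lborel) = ennreal c"
    proof -
      have "ennreal c = (\<integral>\<^sup>+x. ennreal (g x) \<partial>?E)"
        unfolding c_def using int g0 by (subst nn_integral_eq_integral) auto
      also have "\<dots> = (\<integral>\<^sup>+x. \<integral>\<^sup>+l. (indicator {0..} l * indicator {l. l < g x} l) \<partial>lborel \<partial>?E)"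
      proof (intro nn_integral_cong)
        fix x
        have "(\<integral>\<^sup>+l. (indicator {0..} l * indicator {l. l < g x} l) \<partial>lborel) = (\<integral>\<^sup>+l. indicator {0..<g x} l \<partial>lborel)"
          by (intro nn_integral_cong) (auto simp: indicator_def)
        then show "ennreal (g x) = (\<integral>\<^sup>+l. (indicator {0..} l * indicator {l. l < g x} l) \<partial>lborel)"
          using g0[of x] by simp
      qed
      also have "\<dots> = (\<integral>\<^sup>+l. \<integral>\<^sup>+x. (indicator {0..} l * indicator {l. l < g x} l) \<partial>?E \<partial>lborel)"
        by (rule P.Fubini'[symmetric]) measurable
      also have "\<dots> = (\<integral>\<^sup>+l. indicator {0..} l * ennreal (m l) \<partial>lborel)"
      proof (intro nn_integral_cong)
        fix l
        have "(\<integral>\<^sup>+x. (indicator {0..} l * indicator {l. l < g x} l) \<partial>?E)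
           = indicator {0..} l * (\<integral>\<^sup>+x. indicator {x. l < g x} x \<partial>?E)"
          by (subst nn_integral_cmult[symmetric]) (auto simp: indicator_def intro!: nn_integral_cong)
        then show "(\<integral>\<^sup>+x. (indicator {0..} l * indicator {l. l < g x} l) \<partial>?E) = indicator {0..} l * ennreal (m l)"
          by (simp add: m_def E.emeasure_eq_measure)
      qed
      finally show ?thesis ..
    qed
    \<comment> \<open>Markov's inequality at the level \<open>g y / 2\<close>; the layer there
      contains \<open>y\<close> and so has positive measure.\<close>
    have c_pos: "0 < c"
    proof -
      have "g y / 2 * m (g y / 2) \<le> c"
      proof -
        have "g y / 2 * m (g y / 2) = (\<integral>x. g y / 2 * indicator {x. g y / 2 < g x} x \<partial>?E)"
          by (simp add: m_def)
        also have "\<dots> \<le> c"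
          unfolding c_def
        proof (rule integral_mono[OF _ int])
          show "integrable ?E (\<lambda>x. g y / 2 * indicator {x. g y / 2 < g x} x)"
            by (intro E.integrable_const_bound[of _ "g y / 2"]) (use y in \<open>auto simp: indicator_def\<close>)
        qed (use g0 in \<open>auto simp: indicator_def\<close>)
        finally show ?thesis .
      qed
      moreover have "0 < m (g y / 2)" by (rule m_pos[of _ y]) (use y in simp)
      ultimately show ?thesis using y by (smt (verit) half_gt_zero mult_pos_pos)
    qed
    \<comment> \<open>Since \<open>w\<close> is a probability density on the levels and \<open>E {x. l < g (x / s)} = m l powr s\<close>,
      integrating the layer bound against \<open>E\<close> gives \<open>c powr (s - 1) * c\<close>.\<close>
    define w where "w l = m l / c" for l
    have [measurable]: "w \<in> borel_measurable borel" unfolding w_def by measurable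
    have w_mass: "(\<integral>\<^sup>+l. indicator {0..} l * ennreal (w l) \<partial>lborel) = 1"
    proof -
      have "(\<integral>\<^sup>+l. indicator {0..} l * ennreal (w l) \<partial>lborel)
          = (\<integral>\<^sup>+l. ennreal (1 / c) * (indicator {0..} l * ennreal (m l)) \<partial>lborel)"
        using c_pos by (intro nn_integral_cong)
          (auto simp: w_def indicator_def ennreal_mult[symmetric] m_def)
      also have "\<dots> = ennreal (1 / c) * ennreal c"
        by (subst nn_integral_cmult) (auto simp: c_mass)
      also have "\<dots> = 1" using c_pos by (simp flip: ennreal_mult)
      finally show ?thesis .
    qed
    have ptw: "ennreal (g x powr s)
        \<le> (\<integral>\<^sup>+l. indicator {0..} l * indicator {l. l < g x} l * ennreal (w l powr (1 - s)) \<partial>lborel)" for x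
      using m_pos[of _ x] c_pos g0 s w_mass
      by (intro powr_le_nn_integral_layers) (auto simp: w_def)
    have "(\<integral>\<^sup>+x. ennreal (g (x / s) powr s) \<partial>?E)
      \<le> (\<integral>\<^sup>+x. \<integral>\<^sup>+l. indicator {0..} l * indicator {l. l < g (x / s)} l * ennreal (w l powr (1 - s)) \<partial>lborel \<partial>?E)"
      by (intro nn_integral_mono ptw)
    also have "\<dots> = (\<integral>\<^sup>+l. \<integral>\<^sup>+x. indicator {0..} l * indicator {l. l < g (x / s)} l * ennreal (w l powr (1 - s)) \<partial>?E \<partial>lborel)"
      by (rule P.Fubini'[symmetric]) measurable
    also have "\<dots> = (\<integral>\<^sup>+l. ennreal (c powr (s - 1)) * (indicator {0..} l * ennreal (m l)) \<partial>lborel)"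
    proof (intro nn_integral_cong)
      fix l
      have "(\<integral>\<^sup>+x. indicator {0..} l * indicator {l. l < g (x / s)} l * ennreal (w l powr (1 - s)) \<partial>?E)
         = indicator {0..} l * ennreal (w l powr (1 - s)) * (\<integral>\<^sup>+x. indicator {x. l < g (x / s)} x \<partial>?E)"
        by (subst nn_integral_cmult[symmetric]) (auto simp: indicator_def intro!: nn_integral_cong)
      also have "(\<integral>\<^sup>+x. indicator {x. l < g (x / s)} x \<partial>?E) = ennreal (m l powr s)"
        by (simp add: m_s E.emeasure_eq_measure)
      also have "indicator {0..} l * ennreal (w l powr (1 - s)) * ennreal (m l powr s)
         = indicator {0..} l * ennreal (w l powr (1 - s) * m l powr s)"
        by (simp add: mult.assoc flip: ennreal_mult)
      \<comment> \<open>The powers of \<open>m l\<close> combine to exponent 1; where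
        \<open>m l = 0\<close>, both sides vanish.\<close>
      also have "w l powr (1 - s) * m l powr s = c powr (s - 1) * m l"
        using c_pos measure_nonneg[of ?E "{x. l < g x}"]
        by (auto simp: w_def powr_divide powr_diff m_def powr_eq_0_iff field_simps)
      finally show "(\<integral>\<^sup>+x. indicator {0..} l * indicator {l. l < g (x / s)} l * ennreal (w l powr (1 - s)) \<partial>?E)
         = ennreal (c powr (s - 1)) * (indicator {0..} l * ennreal (m l))"
        by (simp add: ennreal_mult m_def mult_ac)
    qed
    also have "\<dots> = ennreal (c powr (s - 1)) * ennreal c"
      by (subst nn_integral_cmult) (auto simp: c_mass)
    also have "\<dots> = ennreal (c powr s)"
      using c_pos by (simp add: powr_diff flip: ennreal_mult)
    finally have le: "(\<integral>\<^sup>+x. ennreal (g (x / s) powr s) \<partial>?E) \<le> ennreal (c powr s)" .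
    have "(\<integral>x. g (x / s) powr s \<partial>?E) = enn2real (\<integral>\<^sup>+x. ennreal (g (x / s) powr s) \<partial>?E)"
      by (rule integral_eq_nn_integral) auto
    also have "\<dots> \<le> c powr s"
      using le by (simp add: enn2real_leI)
    finally show ?thesis by (simp add: c_def)
  qed
qed

section \<open>Tensorisation over finitely many coordinates\<close>

abbreviation exponential_product :: "'i set \<Rightarrow> ('i \<Rightarrow> real) measure" where
  "exponential_product I \<equiv> Pi\<^sub>M I (\<lambda>_. std_exponential)"

text \<open>Induction on the coordinates. Integrating one out of an increasing function into
  \<open>[0,1]\<close> gives another such function, whereas an indicator need not stay an indicator;
  hence the statement for functions rather than for upper sets.\<close>

lemma exponential_product_dilation:
  fixes F :: "('i \<Rightarrow> real) \<Rightarrow> real"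
  assumes "finite I" and "1 \<le> s"
    and "F \<in> borel_measurable (exponential_product I)"
    and "\<And>x y. (\<And>i. i \<in> I \<Longrightarrow> x i \<le> y i) \<Longrightarrow> F x \<le> F y"
    and "\<And>x. 0 \<le> F x" and "\<And>x. F x \<le> 1"
  shows "(\<integral>x. F (\<lambda>i. x i / s) powr s \<partial>exponential_product I)
    \<le> (\<integral>x. F x \<partial>exponential_product I) powr s"
  using assms
proof (induction I arbitrary: F rule: finite_induct)
  case empty
  \<comment> \<open>With no coordinates the monotonicity hypothesis compares any two points in both
    directions, so \<open>F\<close> is constant; \<open>undefined\<close> is just a point of
    evaluation.\<close>
  define c where "c = F undefined"
  have "F x = c" for x
    unfolding c_def by (intro antisym empty.prems(3)) auto
  then have F: "F = (\<lambda>_. c)" by auto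
  interpret P: prob_space "exponential_product ({} :: 'i set)"
    by (intro prob_space_PiM prob_space_std_exponential)
  show ?case unfolding F by (simp only: lebesgue_integral_const P.prob_space scaleR_one order_refl)
next
  case (insert k I)
  let ?E = std_exponential
  interpret E: prob_space ?E by (rule prob_space_std_exponential)
  interpret product_prob_space "\<lambda>_::'i. ?E" "I" ..
  interpret J: prob_space "exponential_product (insert k I)"
    by (intro prob_space_PiM prob_space_std_exponential)
  note s = insert.prems(1) and F[measurable] = insert.prems(2)
    and mono = insert.prems(3) and F0 = insert.prems(4) and F1 = insert.prems(5)
  define G where "G x = (\<integral>y. F (x(k := y)) \<partial>?E)" for x
  have mono_section: "mono (\<lambda>y. F (x(k := y)))" for x
    by (intro monoI mono) auto
  note [measurable] = borel_measurable_mono[OF mono_section]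
  have int_section: "integrable ?E (\<lambda>y. F (x(k := y)))" for x
    using F0 F1 by (intro E.integrable_const_bound[of _ 1]) auto
  \<comment> \<open>Monotonicity makes \<open>F\<close> independent of coordinates outside the index
    set, so the scaled point may be restricted to an element of the product space, where
    measurability applies.\<close>
  have "(\<lambda>x. F (\<lambda>i. x i / s)) = (\<lambda>x. F (\<lambda>i\<in>insert k I. x i / s))"
    by (intro ext antisym mono) auto
  also have "\<dots> \<in> borel_measurable (exponential_product (insert k I))"
    by measurable
  finally have [measurable]:
    "(\<lambda>x. F (\<lambda>i. x i / s)) \<in> borel_measurable (exponential_product (insert k I))" .
  have G_meas[measurable]: "G \<in> borel_measurable (exponential_product I)"
    unfolding G_def by measurable
  have G_mono: "G x \<le> G y" if "\<And>i. i \<in> I \<Longrightarrow> x i \<le> y i" for x y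
    unfolding G_def using that by (intro integral_mono int_section mono) auto
  have G0: "0 \<le> G x" for x
    unfolding G_def using F0 by simp
  have G1: "G x \<le> 1" for x
  proof -
    have "G x \<le> (\<integral>y. 1 \<partial>?E)"
      unfolding G_def using F1 by (intro integral_mono int_section) auto
    then show ?thesis using E.prob_space by simp
  qed
  have "(\<integral>x. F (\<lambda>i. x i / s) powr s \<partial>exponential_product (insert k I))
     = (\<integral>x. \<integral>y. F (\<lambda>i. (x(k := y)) i / s) powr s \<partial>?E \<partial>exponential_product I)"
    using insert.hyps s F0 F1
    by (intro product_integral_insert J.integrable_const_bound[of _ 1]) (auto intro!: powr_le1)
  \<comment> \<open>The one-dimensional inequality in the coordinate \<open>k\<close>, with the
    others frozen at \<open>x i / s\<close>; the induction hypothesis for \<open>G\<close> then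
    handles those.\<close>
  also have "\<dots> \<le> (\<integral>x. G (\<lambda>i. x i / s) powr s \<partial>exponential_product I)"
  proof (rule integral_mono_AE')
    have "(\<integral>y. F (\<lambda>i. (x(k := y)) i / s) powr s \<partial>?E) \<le> G (\<lambda>i. x i / s) powr s" for x
    proof -
      have "(\<lambda>i. (x(k := y)) i / s) = (\<lambda>i. x i / s)(k := y / s)" for y
        by auto
      then show ?thesis
        unfolding G_def
        using std_exponential_dilation[OF mono_section F0 F1 s, of "\<lambda>i. x i / s"] by (simp only:)
    qed
    then show "AE x in exponential_product I.
        (\<integral>y. F (\<lambda>i. (x(k := y)) i / s) powr s \<partial>?E) \<le> G (\<lambda>i. x i / s) powr s"
      by simp
    have "(\<lambda>x. G (\<lambda>i. x i / s)) = (\<lambda>x. G (\<lambda>i\<in>I. x i / s))"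
      by (intro ext antisym G_mono) auto
    also have "\<dots> \<in> borel_measurable (exponential_product I)"
      by measurable
    finally show "integrable (exponential_product I) (\<lambda>x. G (\<lambda>i. x i / s) powr s)"
      using G0 G1 s by (intro P.integrable_const_bound[of _ 1]) (auto intro!: powr_le1)
  qed simp
  also have "\<dots> \<le> (\<integral>x. G x \<partial>exponential_product I) powr s"
    by (intro insert.IH s G_mono G0 G1 G_meas)
  also have "(\<integral>x. G x \<partial>exponential_product I) = (\<integral>x. F x \<partial>exponential_product (insert k I))"
    unfolding G_def using insert.hyps F0 F1
    by (intro product_integral_insert[symmetric] J.integrable_const_bound[of _ 1]) auto
  finally show ?case .
qed

section \<open>Squared moduli of Gaussian coordinates\<close>

lemma emeasure_lborel_half_square_le:
  "emeasure lborel {z::complex. (cmod z)\<^sup>2 / 2 \<le> a} = ennreal (2 * pi * max a 0)"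
proof (cases "0 \<le> a")
  case True
  have "(cmod z)\<^sup>2 / 2 \<le> a \<longleftrightarrow> cmod z \<le> sqrt (2 * a)" for z
    using real_sqrt_le_iff[of "(cmod z)\<^sup>2" "2 * a"] by (simp add: mult.commute)
  then have "{z::complex. (cmod z)\<^sup>2 / 2 \<le> a} = cball 0 (sqrt (2 * a))"
    by (simp only: cball_def dist_0_norm)
  then show ?thesis
    using True by (simp add: emeasure_cball unit_ball_vol_2 mult_ac)
next
  case False
  then have "\<not> (cmod z)\<^sup>2 / 2 \<le> a" for z
    using zero_le_power2[of "cmod z"] by linarith
  then show ?thesis using False by simp
qed

text \<open>Polar coordinates without a Jacobian: the disc where the half square is at most
  \<open>a\<close> has area linear in \<open>a\<close>, and the half-lines \<open>{..a}\<close> are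
  an intersection-stable generator.\<close>

lemma distr_lborel_half_square:
  "distr lborel borel (\<lambda>z::complex. (cmod z)\<^sup>2 / 2)
    = density lborel (\<lambda>x::real. ennreal (2 * pi) * indicator {0..} x)" (is "?L = ?R")
proof (rule measure_eqI_generator_eq)
  have R: "emeasure ?R {..a} = ennreal (2 * pi * max a 0)" for a :: real
  proof -
    have "emeasure ?R {..a} = (\<integral>\<^sup>+x. ennreal (2 * pi) * indicator {0..a} x \<partial>lborel)"
      by (subst emeasure_density) (auto simp: indicator_def intro!: nn_integral_cong)
    also have "\<dots> = ennreal (2 * pi * max a 0)"
      by (cases "0 \<le> a") (simp_all add: nn_integral_cmult ennreal_mult)
    finally show ?thesis .
  qed
  have L: "emeasure ?L {..a} = ennreal (2 * pi * max a 0)" for a :: real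
    unfolding emeasure_lborel_half_square_le[symmetric]
    by (subst emeasure_distr) (auto intro!: arg_cong[where f="emeasure lborel"])
  show "Int_stable (range atMost :: real set set)"
    by (auto simp: Int_stable_def)
  show "emeasure ?L X = emeasure ?R X" if "X \<in> range atMost" for X
    using that L R by auto
  show "emeasure ?L {..real i} \<noteq> \<infinity>" for i by (simp add: L)
  show "(\<Union>i. {..real i}) = UNIV" using real_arch_simple by auto
  show "sets ?L = sigma_sets UNIV (range atMost)" "sets ?R = sigma_sets UNIV (range atMost)"
    by (simp_all add: borel_eq_atMost)
qed auto

text \<open>The planar Gaussian density depends on \<open>z\<close> only through its half square, so
  it is carried along by the pushforward, and the two factors \<open>2 * pi\<close> cancel.\<close>

lemma nn_integral_half_square:
  fixes f :: "real \<Rightarrow> ennreal"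
  assumes [measurable]: "f \<in> borel_measurable borel"
  shows "(\<integral>\<^sup>+z. f ((cmod z)\<^sup>2 / 2) * ennreal (exp (- (cmod z)\<^sup>2 / 2) / (2 * pi)) \<partial>lborel)
    = (\<integral>\<^sup>+x. f x \<partial>std_exponential)"
proof -
  have "(\<integral>\<^sup>+z. f ((cmod z)\<^sup>2 / 2) * ennreal (exp (- (cmod z)\<^sup>2 / 2) / (2 * pi)) \<partial>lborel)
     = (\<integral>\<^sup>+x. f x * ennreal (exp (- x) / (2 * pi)) \<partial>distr lborel borel (\<lambda>z::complex. (cmod z)\<^sup>2 / 2))"
    by (subst nn_integral_distr) auto
  also have "\<dots> = (\<integral>\<^sup>+x. (ennreal (2 * pi) * indicator {0..} x) * (f x * ennreal (exp (- x) / (2 * pi))) \<partial>lborel)"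
    unfolding distr_lborel_half_square by (rule nn_integral_density) auto
  also have "\<dots> = (\<integral>\<^sup>+x. ennreal (exponential_density 1 x) * f x \<partial>lborel)"
  proof (intro nn_integral_cong)
    fix x :: real
    have "ennreal (2 * pi) * ennreal (exp (- x) / (2 * pi)) = ennreal (exp (- x))"
      by (simp flip: ennreal_mult')
    then show "(ennreal (2 * pi) * indicator {0..} x) * (f x * ennreal (exp (- x) / (2 * pi)))
        = ennreal (exponential_density 1 x) * f x"
      by (auto simp: exponential_density_def indicator_def mult.assoc mult.left_commute[of _ "f x"])
        (simp add: mult.commute)
  qed
  also have "\<dots> = (\<integral>\<^sup>+x. f x \<partial>std_exponential)"
    by (rule nn_integral_density[symmetric]) auto
  finally show ?thesis .
qed

section \<open>Lebesgue and Gaussian measure as products over complex coordinates\<close>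

lemma measurable_vec_lambda:
  fixes M :: "'n::finite \<Rightarrow> 'a::euclidean_space measure"
  assumes "\<And>k. sets (M k) = sets borel"
  shows "vec_lambda \<in> borel_measurable (Pi\<^sub>M UNIV M)"
proof (subst borel_measurable_euclidean_space, intro ballI)
  fix b :: "'a ^ 'n" assume "b \<in> Basis"
  then obtain k c where b: "b = axis k c" by (auto simp: Basis_vec_def)
  have "(\<lambda>f. f k) \<in> measurable (Pi\<^sub>M UNIV M) (M k)" by simp
  then have [measurable]: "(\<lambda>f. f k) \<in> borel_measurable (Pi\<^sub>M UNIV M)"
    using assms measurable_cong_sets by blast
  show "(\<lambda>f. vec_lambda f \<bullet> b) \<in> borel_measurable (Pi\<^sub>M UNIV M)"
    by (simp add: b inner_axis)
qed

lemma borel_measurable_real_coords[measurable]: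
  "(real_coords :: complex ^ 'n::finite \<Rightarrow> _) \<in> borel_measurable borel"
proof -
  have "continuous_on UNIV (\<lambda>z :: complex ^ 'n. if snd p = 1 then Re (z $ fst p) else Im (z $ fst p))"
    for p :: "'n \<times> 2"
    by (cases "snd p = 1") (auto intro!: continuous_intros)
  then show ?thesis
    unfolding real_coords_def by (intro borel_measurable_continuous_onI continuous_on_vec_lambda)
qed

lemma prod_Basis_cart:
  fixes v :: "real ^ 'i::finite"
  shows "(\<Prod>b\<in>Basis. v \<bullet> b) = (\<Prod>i\<in>UNIV. v $ i)"
proof -
  have B: "(Basis :: (real ^ 'i) set) = range (\<lambda>i. axis i 1)"
    by (auto simp: Basis_vec_def)
  have inj: "inj (\<lambda>i::'i. axis i (1::real))" by (auto simp: inj_def axis_eq_axis)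
  show ?thesis
    unfolding B prod.reindex[OF inj] by (simp add: inner_axis)
qed

text \<open>Lebesgue measure is determined by its values on boxes. A real box pulls back to a
  product of complex rectangles, whose areas multiply to its volume.\<close>

lemma lborel_eq_distr_real_coords:
  "(lborel :: (real ^ ('n::finite \<times> 2)) measure)
    = distr (Pi\<^sub>M UNIV (\<lambda>_::'n. lborel)) borel (\<lambda>f. real_coords (vec_lambda f))"
proof (rule lborel_eqI)
  interpret product_sigma_finite "\<lambda>_::'n. lborel :: complex measure" ..
  note [measurable] = measurable_vec_lambda[of "\<lambda>_::'n. lborel :: complex measure", simplified]
  fix l u :: "real ^ ('n \<times> 2)"
  assume le: "\<And>b. b \<in> Basis \<Longrightarrow> l \<bullet> b \<le> u \<bullet> b"
  have lu: "l $ p \<le> u $ p" for p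
    using le[of "axis p 1"] by (simp add: inner_axis)
  let ?B = "\<lambda>k. box (Complex (l $ (k, 1)) (l $ (k, 2))) (Complex (u $ (k, 1)) (u $ (k, 2)))"
  have "(\<lambda>f. real_coords (vec_lambda f)) -` box l u \<inter> space (Pi\<^sub>M UNIV (\<lambda>_::'n. lborel)) = Pi\<^sub>E UNIV ?B"
    by (auto simp: space_PiM mem_box_cart real_coords_def PiE_iff in_box_complex_iff split_paired_all forall_2)
  then have "emeasure (distr (Pi\<^sub>M UNIV (\<lambda>_::'n. lborel)) borel (\<lambda>f. real_coords (vec_lambda f))) (box l u)
     = emeasure (Pi\<^sub>M UNIV (\<lambda>_::'n. lborel)) (Pi\<^sub>E UNIV ?B)"
    by (subst emeasure_distr) auto
  also have "\<dots> = (\<Prod>k\<in>UNIV. emeasure lborel (?B k))"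
    by (rule emeasure_PiM) auto
  also have "\<dots> = (\<Prod>k\<in>UNIV. ennreal ((u - l) $ (k, 1) * (u - l) $ (k, 2)))"
    using lu by (intro prod.cong refl, subst emeasure_lborel_box)
      (auto simp: Basis_complex_def inner_complex_def)
  also have "\<dots> = ennreal (\<Prod>k\<in>UNIV. (u - l) $ (k, 1) * (u - l) $ (k, 2))"
    using lu by (intro prod_ennreal) simp
  also have "(\<Prod>k\<in>UNIV. (u - l) $ (k, 1) * (u - l) $ (k, 2)) = (\<Prod>k\<in>UNIV. \<Prod>q\<in>UNIV. (u - l) $ (k, q))"
    by (simp add: UNIV_2)
  also have "\<dots> = (\<Prod>p\<in>UNIV. (u - l) $ p)"
    by (simp add: prod.cartesian_product)
  also have "\<dots> = (\<Prod>b\<in>Basis. (u - l) \<bullet> b)"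
    by (rule prod_Basis_cart[symmetric])
  finally show "emeasure (distr (Pi\<^sub>M UNIV (\<lambda>_::'n. lborel)) borel (\<lambda>f. real_coords (vec_lambda f))) (box l u)
     = (\<Prod>b\<in>Basis. (u - l) \<bullet> b)" .
qed simp

lemma norm_real_coords_sq: "(norm (real_coords z))\<^sup>2 = (\<Sum>k\<in>UNIV. (cmod (z $ k))\<^sup>2)"
proof -
  have "(norm (real_coords z))\<^sup>2 = (\<Sum>p\<in>UNIV. (real_coords z $ p)\<^sup>2)"
    by (simp add: norm_vec_def L2_set_def sum_nonneg)
  also have "\<dots> = (\<Sum>k\<in>UNIV. \<Sum>q\<in>UNIV. (real_coords z $ (k, q))\<^sup>2)"
    by (simp add: sum.cartesian_product)
  also have "\<dots> = (\<Sum>k\<in>UNIV. (cmod (z $ k))\<^sup>2)"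
    by (simp add: UNIV_2 real_coords_def cmod_power2)
  finally show ?thesis .
qed

lemma sets_complex_gaussian[measurable_cong, simp]: "sets complex_gaussian = sets borel"
  and space_complex_gaussian[simp]: "space complex_gaussian = UNIV"
  by (simp_all add: complex_gaussian_def)

text \<open>Change of variables through \<open>real_coords\<close>; the squared norm is a sum over
  complex coordinates, so the density factors.\<close>

lemma nn_integral_complex_gaussian:
  fixes f :: "complex ^ 'n::finite \<Rightarrow> ennreal"
  assumes [measurable]: "f \<in> borel_measurable borel"
  shows "(\<integral>\<^sup>+z. f z \<partial>complex_gaussian)
    = (\<integral>\<^sup>+x. f (vec_lambda x) * (\<Prod>k\<in>UNIV. ennreal (exp (- (cmod (x k))\<^sup>2 / 2) / (2 * pi)))
        \<partial>Pi\<^sub>M UNIV (\<lambda>_::'n. lborel))"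
proof -
  note [measurable] = measurable_vec_lambda[of "\<lambda>_::'n. lborel :: complex measure", simplified]
    borel_measurable_inv_real_coords
  have inv: "inv real_coords (real_coords z) = z" for z :: "complex ^ 'n"
    by (simp add: inj_real_coords)
  have rg: "sets (real_gaussian :: (real ^ ('n \<times> 2)) measure) = sets borel"
    by (simp add: real_gaussian_def)
  have "(\<integral>\<^sup>+z. f z \<partial>complex_gaussian) = (\<integral>\<^sup>+x. f (inv real_coords x) \<partial>real_gaussian)"
    unfolding complex_gaussian_def
    by (rule nn_integral_distr) (simp_all add: measurable_cong_sets[OF rg refl])
  also have "\<dots> = (\<integral>\<^sup>+x. ennreal (exp (- (norm x)\<^sup>2 / 2) / (2 * pi) ^ CARD('n)) * f (inv real_coords x) \<partial>lborel)"
    unfolding real_gaussian_def by (rule nn_integral_density) auto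
  also have "\<dots> = (\<integral>\<^sup>+x. ennreal (exp (- (norm (real_coords (vec_lambda x)))\<^sup>2 / 2) / (2 * pi) ^ CARD('n))
      * f (vec_lambda x) \<partial>Pi\<^sub>M UNIV (\<lambda>_::'n. lborel))"
    by (subst lborel_eq_distr_real_coords, subst nn_integral_distr) (simp_all add: inv)
  also have "\<dots> = (\<integral>\<^sup>+x. f (vec_lambda x) * (\<Prod>k\<in>UNIV. ennreal (exp (- (cmod (x k))\<^sup>2 / 2) / (2 * pi)))
        \<partial>Pi\<^sub>M UNIV (\<lambda>_::'n. lborel))"
    by (intro nn_integral_cong)
      (simp add: norm_real_coords_sq prod_ennreal prod_dividef exp_sum[symmetric] sum_negf
        sum_divide_distrib mult.commute)
  finally show ?thesis .
qed

text \<open>The half squares are independent standard exponentials. On rectangles the integral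
  factors by Fubini into one-coordinate integrals, and rectangles determine the product
  measure.\<close>

lemma distr_complex_gaussian_half_squares:
  "distr complex_gaussian (exponential_product UNIV) (\<lambda>z k. (cmod (z $ k))\<^sup>2 / 2)
    = exponential_product (UNIV :: 'n::finite set)"
proof -
  interpret E: prob_space std_exponential by (rule prob_space_std_exponential)
  interpret P: product_sigma_finite "\<lambda>_::'n. std_exponential" ..
  interpret L: product_sigma_finite "\<lambda>_::'n. lborel :: complex measure" ..
  have meas[measurable]: "(\<lambda>z k. (cmod (z $ k))\<^sup>2 / 2) \<in> measurable borel (exponential_product (UNIV :: 'n set))"
    by (intro measurable_PiM_single') (auto intro!: borel_measurable_continuous_onI continuous_intros)
  show ?thesis
  proof (rule P.PiM_eqI)
    fix A :: "'n \<Rightarrow> real set"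
    assume "\<And>k. k \<in> UNIV \<Longrightarrow> A k \<in> sets std_exponential"
    then have A[measurable]: "A k \<in> sets borel" for k by simp
    have "emeasure (distr complex_gaussian (exponential_product UNIV) (\<lambda>z k. (cmod (z $ k))\<^sup>2 / 2)) (Pi\<^sub>E UNIV A)
        = (\<integral>\<^sup>+z. indicator (Pi\<^sub>E UNIV A) (\<lambda>k. (cmod (z $ k))\<^sup>2 / 2) \<partial>complex_gaussian)"
      by (subst nn_integral_indicator[symmetric], simp add: sets_PiM_I_finite, subst nn_integral_distr)
        (auto intro!: sets_PiM_I_finite simp: measurable_cong_sets[OF sets_complex_gaussian refl])
    also have "\<dots> = (\<integral>\<^sup>+x. indicator (Pi\<^sub>E UNIV A) (\<lambda>k. (cmod (x k))\<^sup>2 / 2)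
        * (\<Prod>k\<in>UNIV. ennreal (exp (- (cmod (x k))\<^sup>2 / 2) / (2 * pi))) \<partial>Pi\<^sub>M UNIV (\<lambda>_::'n. lborel))"
    proof -
      have [measurable]: "Pi\<^sub>E UNIV A \<in> sets (exponential_product UNIV)"
        by (auto intro!: sets_PiM_I_finite)
      have "(\<lambda>z. indicator (Pi\<^sub>E UNIV A) (\<lambda>k. (cmod (z $ k))\<^sup>2 / 2) :: ennreal) \<in> borel_measurable borel"
        by (rule measurable_compose[OF meas]) simp
      then show ?thesis
        by (subst nn_integral_complex_gaussian) simp_all
    qed
    also have "\<dots> = (\<integral>\<^sup>+x. (\<Prod>k\<in>UNIV. indicator (A k) ((cmod (x k))\<^sup>2 / 2)
        * ennreal (exp (- (cmod (x k))\<^sup>2 / 2) / (2 * pi))) \<partial>Pi\<^sub>M UNIV (\<lambda>_::'n. lborel))"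
    proof (intro nn_integral_cong)
      fix x :: "'n \<Rightarrow> complex"
      have "indicator (Pi\<^sub>E UNIV A) (\<lambda>k. (cmod (x k))\<^sup>2 / 2)
         = (\<Prod>k\<in>UNIV. indicator (A k) ((cmod (x k))\<^sup>2 / 2) :: ennreal)"
        by (auto simp: indicator_def PiE_iff)
      then show "indicator (Pi\<^sub>E UNIV A) (\<lambda>k. (cmod (x k))\<^sup>2 / 2)
          * (\<Prod>k\<in>UNIV. ennreal (exp (- (cmod (x k))\<^sup>2 / 2) / (2 * pi)))
        = (\<Prod>k\<in>UNIV. indicator (A k) ((cmod (x k))\<^sup>2 / 2) * ennreal (exp (- (cmod (x k))\<^sup>2 / 2) / (2 * pi)))"
        by (simp add: prod.distrib)
    qed
    also have "\<dots> = (\<Prod>k\<in>UNIV. \<integral>\<^sup>+z. indicator (A k) ((cmod z)\<^sup>2 / 2)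
        * ennreal (exp (- (cmod z)\<^sup>2 / 2) / (2 * pi)) \<partial>lborel)"
      by (rule L.product_nn_integral_prod) auto
    also have "\<dots> = (\<Prod>k\<in>UNIV. emeasure std_exponential (A k))"
      by (subst nn_integral_half_square) auto
    finally show "emeasure (distr complex_gaussian (exponential_product UNIV) (\<lambda>z k. (cmod (z $ k))\<^sup>2 / 2)) (Pi\<^sub>E UNIV A)
        = (\<Prod>k\<in>UNIV. emeasure std_exponential (A k))" .
  qed simp_all
qed

lemma emeasure_complex_gaussian_half_squares:
  fixes A :: "('n::finite \<Rightarrow> real) set"
  assumes A: "A \<in> sets (exponential_product UNIV)"
  shows "emeasure complex_gaussian {z. (\<lambda>k. (cmod (z $ k))\<^sup>2 / 2) \<in> A}
    = ennreal (measure (exponential_product UNIV) A)"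
proof -
  interpret P: prob_space "exponential_product (UNIV :: 'n set)"
    by (intro prob_space_PiM prob_space_std_exponential)
  have meas: "(\<lambda>z k. (cmod (z $ k))\<^sup>2 / 2) \<in> measurable complex_gaussian (exponential_product (UNIV :: 'n set))"
    unfolding measurable_cong_sets[OF sets_complex_gaussian refl]
    by (intro measurable_PiM_single') (auto intro!: borel_measurable_continuous_onI continuous_intros)
  have "emeasure (exponential_product UNIV) A
     = emeasure (distr complex_gaussian (exponential_product UNIV) (\<lambda>z k. (cmod (z $ k))\<^sup>2 / 2)) A"
    by (simp only: distr_complex_gaussian_half_squares)
  also have "\<dots> = emeasure complex_gaussian {z. (\<lambda>k. (cmod (z $ k))\<^sup>2 / 2) \<in> A}"
    using A by (subst emeasure_distr[OF meas]) (auto simp: vimage_def)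
  finally show ?thesis by (simp add: P.emeasure_eq_measure)
qed

section \<open>Reinhardt complete sets\<close>

text \<open>
  The complement of \<open>K\<close> in the coordinates \<open>x k = (cmod (z $ k))\<^sup>2 / 2\<close>; the \<open>max\<close> makes it an
  upper set in all of \<open>\<real>\<^sup>n\<close>, not only in the positive orthant.
\<close>

definition excess_set :: "(complex ^ 'n::finite) set \<Rightarrow> ('n \<Rightarrow> real) set" where
  "excess_set K = {x. (\<chi> k. complex_of_real (sqrt (2 * max (x k) 0))) \<notin> K}"

lemma Reinhardt_complete_norm_cong:
  assumes "Reinhardt_complete K" "\<And>k. cmod (w $ k) = cmod (z $ k)"
  shows "w \<in> K \<longleftrightarrow> z \<in> K"
  using assms unfolding Reinhardt_complete_def by (metis order_refl)

text \<open>The vector tested in \<open>excess_set\<close> is \<open>z\<close> with its phases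
  removed, and \<open>K\<close> does not see phases.\<close>

lemma mem_excess_set:
  assumes "Reinhardt_complete K"
  shows "(\<lambda>k. (cmod (z $ k))\<^sup>2 / 2) \<in> excess_set K \<longleftrightarrow> z \<notin> K"
  unfolding excess_set_def mem_Collect_eq
  by (intro arg_cong[where f=Not] Reinhardt_complete_norm_cong[OF assms]) simp

lemma excess_set_upper:
  assumes "Reinhardt_complete K" "x \<in> excess_set K" "\<And>k. x k \<le> y k"
  shows "y \<in> excess_set K"
proof -
  have "max (x k) 0 \<le> max (y k) 0" for k
    using assms(3)[of k] by linarith
  then show ?thesis
    using assms(1,2) unfolding excess_set_def Reinhardt_complete_def by auto
qed

text \<open>Closedness of \<open>K\<close> enters here: its open complement is pulled back along a
  continuous map.\<close>

lemma excess_set_measurable: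
  fixes K :: "(complex ^ 'n::finite) set"
  assumes "closed K"
  shows "excess_set K \<in> sets (exponential_product UNIV)"
proof -
  have cont: "(\<lambda>x::real ^ 'n. (\<chi> k. complex_of_real (sqrt (2 * max (x $ k) 0)))) \<in> borel_measurable borel"
    by (intro borel_measurable_continuous_onI continuous_on_vec_lambda) (auto intro!: continuous_intros)
  have "vec_lambda \<in> borel_measurable (exponential_product (UNIV :: 'n set))"
    by (rule measurable_vec_lambda) simp
  from measurable_compose[OF this cont]
  have "(\<lambda>x. (\<chi> k. complex_of_real (sqrt (2 * max (x k) 0))))
      \<in> borel_measurable (exponential_product (UNIV :: 'n set))"
    by (simp only: vec_lambda_beta)
  from measurable_sets[OF this, of "- K"] assms show ?thesis
    by (auto simp: excess_set_def vimage_def space_PiM)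
qed

lemma measurable_scale_exponential_product:
  "(\<lambda>x k. x k / s) \<in> measurable (exponential_product (UNIV :: 'n set)) (exponential_product UNIV)"
  by (intro measurable_PiM_single') auto

section \<open>Gaussian measures of dilates and the comparison with cylinders\<close>

text \<open>The scale is \<open>t\<close> squared because the half squares are quadratic: dividing
  \<open>z\<close> by \<open>t\<close> divides each of them by that factor.\<close>

lemma emeasure_dilate_Reinhardt:
  fixes K :: "(complex ^ 'n::finite) set"
  assumes "closed K" and K: "Reinhardt_complete K" and t: "0 < t"
  shows "emeasure complex_gaussian (dilate t K)
    = ennreal (1 - measure (exponential_product UNIV) {x. (\<lambda>k. x k / t\<^sup>2) \<in> excess_set K})"
proof -
  interpret P: prob_space "exponential_product (UNIV :: 'n set)"
    by (intro prob_space_PiM prob_space_std_exponential)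
  let ?U = "{x. (\<lambda>k. x k / t\<^sup>2) \<in> excess_set K}"
  have space: "space (exponential_product (UNIV :: 'n set)) = UNIV"
    by (simp add: space_PiM)
  have U: "?U \<in> P.events"
    using measurable_sets[OF measurable_scale_exponential_product excess_set_measurable[OF assms(1)], of "t\<^sup>2"]
    by (simp add: space vimage_def)
  have "z \<in> dilate t K \<longleftrightarrow> z /\<^sub>R t \<in> K" for z
  proof
    assume "z /\<^sub>R t \<in> K"
    moreover have "z = t *\<^sub>R (z /\<^sub>R t)" using t by simp
    ultimately show "z \<in> dilate t K" unfolding dilate_def by blast
  qed (use t in \<open>auto simp: dilate_def\<close>)
  moreover have "(\<lambda>k. (cmod ((z /\<^sub>R t) $ k))\<^sup>2 / 2) = (\<lambda>k. (cmod (z $ k))\<^sup>2 / 2 / t\<^sup>2)" for z :: "complex ^ 'n"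
    using t by (auto simp: field_simps power_mult_distrib power_inverse)
  ultimately have "dilate t K = {z. (\<lambda>k. (cmod (z $ k))\<^sup>2 / 2) \<in> - ?U}"
    using mem_excess_set[OF K, of "_ /\<^sub>R t"] by auto
  moreover have "- ?U \<in> P.events"
    using sets.compl_sets[OF U] by (simp add: space Compl_eq_Diff_UNIV)
  ultimately have "emeasure complex_gaussian (dilate t K) = ennreal (P.prob (- ?U))"
    by (simp only: emeasure_complex_gaussian_half_squares)
  then show ?thesis
    using P.prob_compl[OF U] by (simp add: space Compl_eq_Diff_UNIV)
qed

text \<open>The functional inequality for an indicator, which is increasing because the set is
  upper; \<open>powr s\<close> fixes the values 0 and 1.\<close>

lemma excess_set_dilation:
  fixes K :: "(complex ^ 'n::finite) set"
  assumes "closed K" and K: "Reinhardt_complete K" and s: "1 \<le> s"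
  shows "measure (exponential_product UNIV) {x. (\<lambda>k. x k / s) \<in> excess_set K}
    \<le> measure (exponential_product UNIV) (excess_set K) powr s"
proof -
  let ?F = "indicator (excess_set K) :: _ \<Rightarrow> real"
  have space: "space (exponential_product (UNIV :: 'n set)) = UNIV"
    by (simp add: space_PiM)
  have "(\<integral>x. ?F (\<lambda>k. x k / s) powr s \<partial>exponential_product UNIV)
      \<le> (\<integral>x. ?F x \<partial>exponential_product UNIV) powr s"
    by (rule exponential_product_dilation)
      (use s excess_set_measurable[OF assms(1)] excess_set_upper[OF K] in \<open>auto simp: indicator_def\<close>)
  moreover have "?F (\<lambda>k. x k / s) powr s = indicator {x. (\<lambda>k. x k / s) \<in> excess_set K} x" for x
    by (simp add: indicator_def)
  ultimately show ?thesis by (simp add: space)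
qed

text \<open>In half squares the cylinder is a half-line condition on the single coordinate
  \<open>j\<close>, so its complement has an exponential tail as measure.\<close>

lemma emeasure_cylinder:
  fixes j :: "'n::finite"
  assumes "0 \<le> R"
  shows "emeasure complex_gaussian (cylinder j R) = ennreal (1 - exp (- R\<^sup>2 / 2))"
proof -
  interpret E: prob_space std_exponential by (rule prob_space_std_exponential)
  interpret product_prob_space "\<lambda>_::'n. std_exponential" UNIV ..
  have "cmod (z $ j) \<le> R \<longleftrightarrow> (cmod (z $ j))\<^sup>2 / 2 \<le> R\<^sup>2 / 2" for z :: "complex ^ 'n"
    using assms by (simp add: power_mono_iff)
  then have "cylinder j R = {z. (\<lambda>k. (cmod (z $ k))\<^sup>2 / 2) \<in> {x. x j \<in> {..R\<^sup>2 / 2}}}"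
    by (auto simp: cylinder_def)
  moreover have "{x. x j \<in> {..R\<^sup>2 / 2}} \<in> sets (exponential_product (UNIV :: 'n set))"
  proof -
    have "{x \<in> space (exponential_product UNIV). x j \<in> {..R\<^sup>2 / 2}} \<in> sets (exponential_product (UNIV :: 'n set))"
      by measurable
    then show ?thesis by (simp add: space_PiM)
  qed
  ultimately have "emeasure complex_gaussian (cylinder j R)
     = ennreal (measure (exponential_product (UNIV :: 'n set)) {x. x j \<in> {..R\<^sup>2 / 2}})"
    by (simp only: emeasure_complex_gaussian_half_squares)
  also have "measure (exponential_product (UNIV :: 'n set)) {x. x j \<in> {..R\<^sup>2 / 2}} = E.prob {..R\<^sup>2 / 2}"
    using emeasure_PiM_Collect_single[of j "{..R\<^sup>2 / 2}"] by (simp add: space_PiM measure_def)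
  also have "\<dots> = 1 - E.prob {R\<^sup>2 / 2<..}"
  proof -
    have "{..R\<^sup>2 / 2} = UNIV - {R\<^sup>2 / 2<..}" by auto
    then show ?thesis using E.prob_compl[of "{R\<^sup>2 / 2<..}"] by simp
  qed
  also have "\<dots> = 1 - exp (- R\<^sup>2 / 2)"
    by (simp add: measure_std_exponential_tail)
  finally show ?thesis .
qed

lemma dilate_cylinder:
  assumes "0 < t"
  shows "dilate t (cylinder j R) = cylinder j (t * R)"
proof (intro set_eqI iffI)
  fix z assume z: "z \<in> cylinder j (t * R)"
  then have "z /\<^sub>R t \<in> cylinder j R"
    using assms by (simp add: cylinder_def field_simps)
  moreover have "z = t *\<^sub>R (z /\<^sub>R t)" using assms by simp
  ultimately show "z \<in> dilate t (cylinder j R)" unfolding dilate_def by blast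
qed (use assms in \<open>auto simp: dilate_def cylinder_def\<close>)

theorem theorem1:
  fixes K :: "(complex ^ 'n::finite) set"
  assumes "closed K"
    and "Reinhardt_complete K"
  shows "supports_complex_S_inequality K"
  unfolding supports_complex_S_inequality_def
proof (intro allI impI)
  fix j :: 'n and R t :: real
  assume R: "0 \<le> R" and t: "1 \<le> t"
    and eq: "emeasure complex_gaussian K = emeasure complex_gaussian (cylinder j R)"
  interpret P: prob_space "exponential_product (UNIV :: 'n set)"
    by (intro prob_space_PiM prob_space_std_exponential)
  \<comment> \<open>Dilation by 1 lets the formula for dilates also give the measure of
    \<open>K\<close> itself.\<close>
  have "dilate 1 K = K" by (simp add: dilate_def)
  then have "ennreal (1 - P.prob (excess_set K)) = ennreal (1 - exp (- R\<^sup>2 / 2))"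
    using emeasure_dilate_Reinhardt[OF assms, of 1] eq emeasure_cylinder[OF R, of j] by simp
  then have U: "P.prob (excess_set K) = exp (- R\<^sup>2 / 2)"
    by (subst (asm) ennreal_inj) auto
  have "P.prob {x. (\<lambda>k. x k / t\<^sup>2) \<in> excess_set K} \<le> P.prob (excess_set K) powr t\<^sup>2"
    using t by (intro excess_set_dilation assms) simp
  \<comment> \<open>The bound is exactly the measure of the complement of the cylinder of radius
    \<open>t * R\<close>; passing to complements then reverses the inequality.\<close>
  also have "\<dots> = exp (- (t * R)\<^sup>2 / 2)"
    by (simp add: U powr_def power_mult_distrib)
  finally have "ennreal (1 - exp (- (t * R)\<^sup>2 / 2))
      \<le> ennreal (1 - P.prob {x. (\<lambda>k. x k / t\<^sup>2) \<in> excess_set K})"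
    by (intro ennreal_leI) simp
  then show "emeasure complex_gaussian (dilate t (cylinder j R)) \<le> emeasure complex_gaussian (dilate t K)"
    using t R emeasure_dilate_Reinhardt[OF assms, of t] dilate_cylinder[of t j R]
      emeasure_cylinder[of "t * R" j] by simp
qed

end
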